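(* Let $G$ be a finite group of order $n$, and let $C_n$ be the cyclic group of order $n$. Then $$\phi(C_n) \geq \phi(G),$$ with equality if and only if $G$ is isomorphic to $C_n$.
   Context: For a finite group $G$ and $g\in G$, $\mathrm{o}(g)$ denotes the order of $g$. On positive integers, $\phi$ denotes the Euler totient function. For a finite group $G$, define $\phi(G)=\sum_{g\in G}\phi(\mathrm{o}(g))$. *)

theory Defs
  imports
    "HOL-Algebra.Elementary_Groups"
    "HOL-Algebra.Multiplicative_Group"
    "HOL-Number_Theory.Totient"
begin

definition group_totient :: "('a, 'b) monoid_scheme \<Rightarrow> nat"
  where "group_totient G = (\<Sum>g\<in>carrier G. totient (group.ord G g))"

end

theory Submission
  imports
    Defs
    "HOL-Algebra.Weak_Morphisms"
begin

text \<open>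
  The value at the cyclic group of order \<open>n\<close> is \<open>F n = \<Sum>d | d dvd n. (\<phi> d)^2\<close>. It suffices to show
  that \<open>F n \<le> \<phi>(G)\<close> forces an element of order \<open>n\<close>, by induction on \<open>n\<close>. Averaging gives \<open>g\<close> with
  \<open>F n \<le> n * \<phi>(ord g)\<close>, and a prime by prime estimate shows for \<open>n > 2\<close> that \<open>\<langle>g\<rangle>\<close> has index less than the
  largest prime divisor \<open>p\<close> of \<open>n\<close>. Therefore \<open>\<langle>g\<rangle>\<close> contains all \<open>p\<close>-elements of \<open>G\<close>, and the Sylow
  \<open>p\<close>-subgroup \<open>Q\<close> is cyclic and normal. On a coset of \<open>Q\<close> that has order \<open>m\<close> in \<open>G/Q\<close> the sum of
  \<open>\<phi>(ord y)\<close> is at most \<open>\<phi>(m) * F |Q|\<close>, strictly unless the coset has an element of order \<open>m * |Q|\<close>.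
  Since \<open>F\<close> is multiplicative, \<open>G/Q\<close> is extremal as well, hence cyclic, and equality at a generating
  coset yields an element of order \<open>n\<close>.
\<close>

section \<open>Arithmetic of the sum of squared totients over the divisors\<close>

definition totient_square_sum :: "nat \<Rightarrow> nat"
  where "totient_square_sum n = (\<Sum>d | d dvd n. (totient d)\<^sup>2)"

lemma totient_square_sum_1 [simp]: "totient_square_sum (Suc 0) = 1"
  by (simp add: totient_square_sum_def)

lemma totient_square_sum_pos:
  assumes "n > 0"
  shows "totient_square_sum n > 0"
  unfolding totient_square_sum_def
  by (rule sum_pos2[of _ 1]) (use assms in auto)

text \<open>Every divisor of \<open>m * n\<close> is uniquely \<open>a * b\<close> with
  \<open>a dvd m\<close> and \<open>b dvd n\<close>; the factors are recovered as gcds with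
  \<open>m\<close> and \<open>n\<close>, and \<open>totient\<close> is multiplicative on
  them.\<close>

lemma totient_square_sum_mult_coprime:
  assumes "coprime m n" "m > 0" "n > 0"
  shows "totient_square_sum (m * n) = totient_square_sum m * totient_square_sum n"
proof -
  have gcds: "gcd (a * b) m = a" "gcd (a * b) n = b" "coprime a b"
    if "a dvd m" "b dvd n" for a b
  proof -
    have "coprime b m" "coprime a n"
      using assms that by (meson coprime_commute coprime_divisors dvd_refl)+
    then have "gcd (a * b) m = gcd a m" "gcd (a * b) n = gcd b n"
      by (simp_all add: gcd_mult_right_right_cancel gcd_mult_right_left_cancel
          gcd_mult_left_right_cancel gcd_mult_left_left_cancel coprime_commute)
    then show "gcd (a * b) m = a" "gcd (a * b) n = b"
      using that by (auto simp: gcd_nat.absorb1)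
    show "coprime a b"
      using assms that coprime_divisors by blast
  qed
  have "totient_square_sum m * totient_square_sum n
    = (\<Sum>(a, b)\<in>{a. a dvd m} \<times> {b. b dvd n}. (totient a)\<^sup>2 * (totient b)\<^sup>2)"
    unfolding totient_square_sum_def by (simp add: sum_product sum.cartesian_product)
  also have "\<dots> = totient_square_sum (m * n)"
    unfolding totient_square_sum_def
  proof (rule sum.reindex_bij_witness[of _ "\<lambda>d. (gcd d m, gcd d n)" "\<lambda>(a, b). a * b"], goal_cases)
    case (1 ab)
    then show ?case
      using gcds by auto
  next
    case (3 d)
    then show ?case
      using division_decomp[of d m n] gcds by auto
  next
    case (5 ab)
    then show ?case
      using gcds by (auto simp: totient_mult_coprime power_mult_distrib)
  qed (auto intro: mult_dvd_mono)
  finally show ?thesis ..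
qed

text \<open>Apart from the term 1 this is a geometric series with ratio \<open>p^2\<close> and first
  term \<open>(p - 1)^2\<close>. The denominator \<open>p + 1\<close> is cleared so that induction
  on \<open>a\<close> reduces to ring arithmetic.\<close>

lemma totient_square_sum_prime_power:
  assumes "prime p"
  shows "real (totient_square_sum (p ^ a)) * (real p + 1) = (real p ^ a)\<^sup>2 * (real p - 1) + 2"
proof -
  have eq: "totient_square_sum (p ^ a) = (\<Sum>i\<le>a. (totient (p ^ i))\<^sup>2)" for a
  proof -
    have "{d. d dvd p ^ a} = (\<lambda>i. p ^ i) ` {..a}"
      using divides_primepow_nat[OF assms] by auto
    moreover have "inj_on (\<lambda>i. p ^ i) {..a}"
      using prime_gt_1_nat[OF assms] by (auto intro!: inj_onI dest: power_inject_exp[THEN iffD1, rotated])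
    ultimately show ?thesis
      unfolding totient_square_sum_def by (simp add: sum.reindex)
  qed
  have p: "p \<ge> 1"
    using assms prime_ge_1_nat by blast
  show ?thesis
    unfolding eq
  proof (induction a)
    case (Suc a)
    have "real (totient (p ^ Suc a)) = real p ^ a * (real p - 1)"
      using totient_prime_power_Suc[OF assms, of a] p by (simp add: of_nat_diff)
    then have "real ((totient (p ^ Suc a))\<^sup>2) * (real p + 1)
        = (real p ^ a)\<^sup>2 * ((real p - 1)\<^sup>2 * (real p + 1))"
      by (simp only: of_nat_power power_mult_distrib mult.assoc)
    moreover have "(real p ^ Suc a)\<^sup>2 = (real p ^ a)\<^sup>2 * (real p)\<^sup>2"
      by (simp add: power_mult_distrib)
    ultimately show ?case
      using Suc p by (simp only: sum.atMost_Suc of_nat_add distrib_right) 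
        (simp add: algebra_simps power2_eq_square)
  qed auto
qed

section \<open>A multiplicative weight and its bounds at prime powers\<close>

text \<open>Writing \<open>h = n * \<phi>(d) / F n\<close> and \<open>k = n / d\<close>, the weight is \<open>h^2 * k\<close>. Averaging provides \<open>h \<ge> 1\<close>,
  so an upper bound on the weight bounds the index \<open>k\<close>; bounding \<open>h * k\<close> instead is too lossy when
  small primes do not divide \<open>d\<close>.\<close>

definition totient_weight :: "nat \<Rightarrow> nat \<Rightarrow> real"
  where "totient_weight n d
    = (real n * real (totient d) / real (totient_square_sum n))\<^sup>2 * (real n / real d)"

lemma totient_weight_1 [simp]: "totient_weight (Suc 0) (Suc 0) = 1"
  by (simp add: totient_weight_def)

lemma totient_weight_nonneg: "totient_weight n d \<ge> 0"
  by (simp add: totient_weight_def)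

lemma totient_weight_mult_coprime:
  assumes "coprime m n" "m > 0" "n > 0" "d dvd m" "e dvd n"
  shows "totient_weight (m * n) (d * e) = totient_weight m d * totient_weight n e"
proof -
  have "coprime d e"
    using assms coprime_divisors by blast
  then show ?thesis
    using assms
    by (simp add: totient_weight_def totient_square_sum_mult_coprime totient_mult_coprime
        power_mult_distrib power_divide mult_ac)
qed

text \<open>Dropping the summand 2 in the closed form of \<open>F (p^a)\<close> bounds
  \<open>p^a / F (p^a)\<close> strictly from above. The cases differ because
  \<open>totient (p^b)\<close> has the factor \<open>1 - 1/p\<close> only for
  \<open>b > 0\<close>.\<close>

lemma totient_weight_prime_power_less:
  assumes "prime p" "a > 0" "b \<le> a"
  shows "totient_weight (p ^ a) (p ^ b)
    < (if b = 0 then ((real p + 1) / (real p - 1))\<^sup>2 / real p ^ a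
       else ((real p + 1) / real p)\<^sup>2 / real p ^ (a - b))"
proof -
  define F where "F = real (totient_square_sum (p ^ a))"
  define x where "x = real p ^ a"
  define y where "y = real p ^ b"
  define r where "r = real p"
  have r: "r > 1"
    unfolding r_def using assms prime_gt_1_nat by simp
  have x: "x > 0" and y: "y > 0"
    using r by (auto simp: x_def y_def r_def)
  have F: "F * (r + 1) = x\<^sup>2 * (r - 1) + 2"
    using totient_square_sum_prime_power[OF assms(1), of a] by (simp add: F_def x_def r_def)
  have "F * (r + 1) > x\<^sup>2 * (r - 1)" "x\<^sup>2 * (r - 1) > 0"
    using F r x by auto
  then have F0: "F > 0"
    using r by (metis add_pos_pos less_trans zero_less_mult_pos2 zero_less_one)
  have bound: "x / F < (r + 1) / (r - 1) / x"
    using \<open>F * (r + 1) > x\<^sup>2 * (r - 1)\<close> r x F0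
    by (simp add: divide_simps power2_eq_square mult_ac)
  show ?thesis
  proof (cases "b = 0")
    case True
    have "totient_weight (p ^ a) (p ^ b) = (x / F)\<^sup>2 * x"
      using True by (simp add: totient_weight_def x_def F_def)
    also have "\<dots> < ((r + 1) / (r - 1) / x)\<^sup>2 * x"
      using bound x F0 by (intro mult_strict_right_mono power_strict_mono) auto
    also have "\<dots> = ((r + 1) / (r - 1))\<^sup>2 / x"
      using x by (simp add: power2_eq_square)
    finally show ?thesis
      using True by (simp add: x_def r_def)
  next
    case False
    have "real (totient (p ^ b)) = y * (r - 1) / r"
      using totient_prime_power_Suc[OF assms(1), of "b - 1"] False r
      by (simp add: y_def r_def of_nat_diff flip: power_Suc)
        (simp add: divide_simps power_eq_if)
    moreover have "p > 0"
      using r by (simp add: r_def)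
    ultimately have "totient_weight (p ^ a) (p ^ b) = (x / F * (y * (r - 1) / r))\<^sup>2 * (x / y)"
      by (simp add: totient_weight_def x_def F_def y_def mult.commute[of r])
    also have "\<dots> < ((r + 1) / (r - 1) / x * (y * (r - 1) / r))\<^sup>2 * (x / y)"
      using bound x y F0 r by (intro mult_strict_right_mono power_strict_mono) auto
    also have "\<dots> = ((r + 1) / r)\<^sup>2 / (x / y)"
      using x y r by (simp add: power2_eq_square divide_simps)
    also have "x / y = r ^ (a - b)"
      using assms r by (simp add: x_def y_def r_def power_diff)
    finally show ?thesis
      using False by (simp add: r_def)
  qed
qed

text \<open>Among the bounds for \<open>b < a\<close>, the one for \<open>b = 0\<close> and
  \<open>a = 1\<close> is the largest.\<close>

lemma totient_weight_prime_power_less_of_less: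
  assumes "prime p" "b < a"
  shows "totient_weight (p ^ a) (p ^ b) < ((real p + 1) / (real p - 1))\<^sup>2 / real p"
proof -
  have p: "real p > 1"
    using assms prime_gt_1_nat by simp
  have pow: "real p \<le> real p ^ k" if "k > 0" for k
    using p that by (simp add: self_le_power)
  have "(if b = 0 then ((real p + 1) / (real p - 1))\<^sup>2 / real p ^ a
       else ((real p + 1) / real p)\<^sup>2 / real p ^ (a - b))
     \<le> ((real p + 1) / (real p - 1))\<^sup>2 / real p"
    using assms p pow[of a] pow[of "a - b"]
    by (auto intro!: frac_le power_mono divide_left_mono mult_pos_pos)
  then show ?thesis
    using totient_weight_prime_power_less[of p a b] assms by simp
qed

lemma totient_weight_prime_power_less_same:
  assumes "prime p" "a > 0"
  shows "totient_weight (p ^ a) (p ^ a) < ((real p + 1) / real p)\<^sup>2"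
  using totient_weight_prime_power_less[of p a a] assms by simp

lemma totient_weight_2_power_le:
  assumes "a > 0" "b \<le> a"
  shows "totient_weight (2 ^ a) (2 ^ b) \<le> 9 / 4"
proof -
  consider "a = 1" "b = 0" | "a \<ge> 2" "b = 0" | "b > 0"
    using assms by fastforce
  then show ?thesis
  proof cases
    \<comment> \<open>The general estimate gives only 9/2 here. The exact value
      \<open>F 2 = 2\<close> yields weight 2.\<close>
    case 1
    have "3 * totient_square_sum 2 = 6"
      using totient_square_sum_prime_power[of 2 1] by simp
    then show ?thesis
      using 1 by (simp add: totient_weight_def)
  next
    case 2
    have "(2::real) ^ 2 \<le> 2 ^ a"
      using 2 by (intro power_increasing) auto
    then have "9 / 2 ^ a \<le> (9 / 4 :: real)"
      by (intro frac_le) auto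
    then show ?thesis
      using totient_weight_prime_power_less[of 2 a b] 2 assms by simp
  next
    case 3
    have "(1::real) \<le> 2 ^ (a - b)"
      by simp
    then have "9 / 4 / 2 ^ (a - b) \<le> (9 / 4 / 1 :: real)"
      by (intro frac_le) auto
    then show ?thesis
      using totient_weight_prime_power_less[of 2 a b] 3 assms by (simp add: power2_eq_square)
  qed
qed

lemma prime_power_decomposition:
  fixes p n d :: nat
  assumes "prime p" "p dvd n" "n > 0" "d dvd n"
  obtains m a e b where "n = m * p ^ a" "d = e * p ^ b" "\<not> p dvd m" "e dvd m"
    "a > 0" "b \<le> a" "coprime m (p ^ a)"
proof -
  have d: "d > 0"
    using assms dvd_pos_nat by blast
  have np: "\<not> is_unit p"
    using assms not_prime_unit by blast
  obtain m where m: "n = m * p ^ multiplicity p n" "\<not> p dvd m"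
    using multiplicity_decompose'[of n p] np assms by (metis mult.commute neq0_conv)
  obtain e where e: "d = e * p ^ multiplicity p d" "\<not> p dvd e"
    using multiplicity_decompose'[of d p] np d by (metis mult.commute neq0_conv)
  have cop: "coprime k (p ^ i)" if "\<not> p dvd k" for k i
    using assms that by (metis coprime_commute coprime_power_right_iff prime_imp_coprime)
  have "e dvd m"
    using cop[OF e(2), of "multiplicity p n"] assms(4) m(1) e(1)
    by (metis coprime_dvd_mult_left_iff dvd_mult_left)
  moreover have "multiplicity p n > 0"
    using assms np by (simp add: multiplicity_gt_zero_iff)
  moreover have "multiplicity p d \<le> multiplicity p n"
    using assms by (intro dvd_imp_multiplicity_le) auto
  ultimately show thesis
    using that m e cop by blast
qed

section \<open>Bounding the weight and the index of a cyclic subgroup\<close>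

text \<open>The local bounds are \<open>9 / 4\<close> at \<open>2\<close>, \<open>16 / 9\<close> at \<open>3\<close> and \<open>(p + 1) / (p - 1)\<close> at \<open>p \<ge> 5\<close>; the product of
  the latter over all odd numbers in \<open>{5..y}\<close> telescopes
  to \<open>(y + 1) / 4\<close>.\<close>

definition weight_bound :: "nat \<Rightarrow> real"
  where "weight_bound y
    = (if y \<le> 1 then 1 else if y = 2 then 9 / 4 else if odd y then real y + 1 else real y)"

lemma weight_bound_Suc: "weight_bound y \<le> weight_bound (Suc y)"
  by (auto simp: weight_bound_def numeral_2_eq_2)

text \<open>This is the step from the primes below \<open>p\<close> to \<open>p\<close>. The sharper
  bound \<open>p\<close> for \<open>b < a\<close> is what later keeps the index below
  \<open>p\<close> itself.\<close>

lemma odd_prime_weight_less: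
  assumes "prime p" "p \<ge> 3" "a > 0" "b \<le> a"
  shows "totient_weight (p ^ a) (p ^ b) * weight_bound (p - 1)
    < (if b < a then real p else real p + 1)"
\<comment> \<open>At 3 the constants fit exactly: \<open>4/3 * 9/4 = 3\<close> and
  \<open>16/9 * 9/4 = 4\<close>, with strictness supplied by the local estimates. For
  \<open>p\<close> at least 5, \<open>weight_bound (p - 1)\<close> is simply
  \<open>p - 1\<close>.\<close>
proof (cases "p = 3")
  case True
  then show ?thesis
    using totient_weight_prime_power_less_of_less[of 3 b a]
      totient_weight_prime_power_less_same[of 3 a] assms
    by (cases "b = a") (auto simp: weight_bound_def power2_eq_square)
next
  case False
  have "odd p"
    using assms prime_odd_nat[of p] by simp
  then have p: "p \<ge> 5"
    using False assms by presburger
  define r where "r = real p"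
  have r: "r \<ge> 5"
    using p by (simp add: r_def)
  have bnd: "weight_bound (p - 1) = r - 1"
  proof -
    have "p - 1 > 2" "even (p - 1)"
      using p \<open>odd p\<close> by auto
    then show ?thesis
      using p by (simp add: weight_bound_def r_def of_nat_diff)
  qed
  show ?thesis
  proof (cases "b < a")
    case True
    have "5 * r \<le> r * r"
      using r by (intro mult_right_mono) auto
    moreover have "(r + 1)\<^sup>2 = r * r + 2 * r + 1"
      by (simp add: power2_eq_square algebra_simps)
    ultimately have "(r + 1)\<^sup>2 \<le> 2 * r\<^sup>2"
      using r unfolding power2_eq_square by linarith
    also have "\<dots> \<le> (r - 1) * r\<^sup>2"
      using r by (intro mult_right_mono) auto
    finally have le: "(r + 1)\<^sup>2 / ((r - 1) * r) \<le> r"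
      using r by (simp add: divide_simps power2_eq_square mult_ac)
    have "totient_weight (p ^ a) (p ^ b) * (r - 1) < ((r + 1) / (r - 1))\<^sup>2 / r * (r - 1)"
      using totient_weight_prime_power_less_of_less[OF assms(1) True] r
      by (intro mult_strict_right_mono) (auto simp: r_def)
    also have "\<dots> = (r + 1)\<^sup>2 / ((r - 1) * r)"
      using r by (simp add: divide_simps power2_eq_square)
    finally show ?thesis
      using True le bnd by (simp add: r_def)
  next
    case False
    then have "b = a"
      using assms by simp
    have "totient_weight (p ^ a) (p ^ b) * (r - 1) < ((r + 1) / r)\<^sup>2 * (r - 1)"
      using totient_weight_prime_power_less_same[OF assms(1,3)] r \<open>b = a\<close>
      by (intro mult_strict_right_mono) (auto simp: r_def)
    also have "\<dots> = (r + 1) * (1 - 1 / r\<^sup>2)"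
      using r by (simp add: field_simps power2_eq_square)
    also have "\<dots> \<le> (r + 1) * 1"
      using r by (intro mult_left_mono) auto
    finally show ?thesis
      using False bnd by (simp add: r_def)
  qed
qed

text \<open>Induction on the bound \<open>y\<close> for the prime divisors. If \<open>Suc y\<close>
  is a prime divisor of \<open>n\<close>, its full power is split off and contributes a local
  weight; otherwise monotonicity of \<open>weight_bound\<close> suffices.\<close>

lemma totient_weight_le:
  assumes "n > 0" "d dvd n" "\<And>p. prime p \<Longrightarrow> p dvd n \<Longrightarrow> p \<le> y"
  shows "totient_weight n d \<le> weight_bound y"
  using assms
proof (induction y arbitrary: n d)
  case 0
  then have "n = 1"
    using prime_factor_nat[of n] prime_gt_0_nat by fastforce
  then show ?case
    using 0 by (simp add: weight_bound_def)
next
  case (Suc y)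
  show ?case
  proof (cases "prime (Suc y) \<and> Suc y dvd n")
    case False
    then have "totient_weight n d \<le> weight_bound y"
      using Suc.prems by (intro Suc.IH) (auto simp: le_Suc_eq)
    then show ?thesis
      using weight_bound_Suc[of y] by simp
  next
    case True
    then obtain m a e b where dec: "n = m * Suc y ^ a" "d = e * Suc y ^ b" "\<not> Suc y dvd m"
      "e dvd m" "a > 0" "b \<le> a" "coprime m (Suc y ^ a)"
      using prime_power_decomposition[of "Suc y" n d] Suc.prems by metis
    have m: "m > 0"
      using dec Suc.prems by auto
    have "p \<le> y" if "prime p" "p dvd m" for p
    proof -
      have "p \<le> Suc y" "p \<noteq> Suc y"
        using Suc.prems(3)[of p] that dec by auto
      then show ?thesis
        by simp
    qed
    then have le: "totient_weight m e \<le> weight_bound y"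
      using m dec by (intro Suc.IH) auto
    have "totient_weight n d = totient_weight m e * totient_weight (Suc y ^ a) (Suc y ^ b)"
      unfolding dec(1,2) using m dec by (intro totient_weight_mult_coprime) (auto simp: le_imp_power_dvd)
    also have "\<dots> \<le> weight_bound y * totient_weight (Suc y ^ a) (Suc y ^ b)"
      using le totient_weight_nonneg by (rule mult_right_mono)
    also have "\<dots> \<le> weight_bound (Suc y)"
    proof (cases "y = 1")
      case True
      then show ?thesis
        using totient_weight_2_power_le[of a b] dec by (simp add: weight_bound_def numeral_2_eq_2)
    next
      case False
      then have "Suc y \<ge> 3"
        using True prime_ge_2_nat[of "Suc y"] by simp
      moreover have "odd (Suc y)"
        using True prime_odd_nat[of "Suc y"] \<open>Suc y \<ge> 3\<close> by simp
      ultimately show ?thesis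
        using odd_prime_weight_less[of "Suc y" a b] True dec
        by (simp add: weight_bound_def mult.commute split: if_splits)
    qed
    finally show ?thesis .
  qed
qed

text \<open>The hypothesis \<open>le\<close> makes the squared factor of the weight at least 1, so
  the weight dominates \<open>n div d\<close>. The power of the largest prime is split off by hand,
  since \<open>weight_bound p = p + 1\<close> alone would not exclude the index
  \<open>p\<close>.\<close>

lemma codivisor_less_max_prime_odd:
  assumes "n > 0" "d dvd n" "prime p" "p dvd n" "p \<ge> 3"
    and max: "\<And>q. prime q \<Longrightarrow> q dvd n \<Longrightarrow> q \<le> p"
    and le: "totient_square_sum n \<le> n * totient d"
  shows "n div d < p"
proof -
  obtain m a e b where dec: "n = m * p ^ a" "d = e * p ^ b" "\<not> p dvd m"
    "e dvd m" "a > 0" "b \<le> a" "coprime m (p ^ a)"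
    using prime_power_decomposition[of p n d] assms by metis
  have m: "m > 0" and d: "d > 0"
    using dec assms dvd_pos_nat by auto
  have "q \<le> p - 1" if "prime q" "q dvd m" for q
    using max[of q] that dec by (cases "q = p") auto
  then have le_m: "totient_weight m e \<le> weight_bound (p - 1)"
    using m dec by (intro totient_weight_le) auto
  have "real (totient_square_sum n) \<le> real (n * totient d)" "totient_square_sum n > 0"
    using le totient_square_sum_pos[of n] assms by linarith+
  then have "1 \<le> real n * real (totient d) / real (totient_square_sum n)"
    by simp
  then have "1 \<le> (real n * real (totient d) / real (totient_square_sum n))\<^sup>2"
    by simp
  then have "real (n div d) * 1 \<le> totient_weight n d"
    unfolding totient_weight_def using assms(2)
    by (metis mult.commute mult_right_mono of_nat_0_le_iff real_of_nat_div)
  also have "totient_weight n d = totient_weight m e * totient_weight (p ^ a) (p ^ b)"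
    unfolding dec(1,2) using m dec assms
    by (intro totient_weight_mult_coprime) (auto simp: le_imp_power_dvd prime_gt_0_nat)
  also have "\<dots> \<le> weight_bound (p - 1) * totient_weight (p ^ a) (p ^ b)"
    using le_m totient_weight_nonneg by (rule mult_right_mono)
  also have "\<dots> < (if b < a then real p else real p + 1)"
    using odd_prime_weight_less[of p a b] assms dec by (simp add: mult.commute)
  finally have less: "real (n div d) < (if b < a then real p else real p + 1)"
    by simp
  show ?thesis
  proof (cases "b < a")
    case True
    then show ?thesis
      using less by simp
  next
    case False
    then have "b = a"
      using dec by simp
    \<comment> \<open>The bound is only \<open>p + 1\<close> here, but the index divides
      \<open>m\<close> and so cannot be \<open>p\<close>.\<close>
    then have "n div d = m div e"
      using dec assms prime_gt_0_nat[of p] by simp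
    then have "\<not> p dvd n div d"
      using dec by (metis dvd_div_mult_self dvd_mult2)
    then have "n div d \<noteq> p"
      by auto
    then show ?thesis
      using less False by simp
  qed
qed

text \<open>If the largest prime is 2, then \<open>n\<close> is a power of 2 and the claim becomes
  \<open>d = n\<close>: for proper divisors \<open>n * totient d\<close> is below
  \<open>F n = (n^2 + 2) / 3\<close>. The case \<open>n = 2\<close>, \<open>d = 1\<close> is a
  genuine exception, as both sides of \<open>le\<close> are then 2.\<close>

lemma codivisor_less_max_prime:
  assumes "n > 2" "d dvd n" "prime p" "p dvd n"
    and max: "\<And>q. prime q \<Longrightarrow> q dvd n \<Longrightarrow> q \<le> p"
    and le: "totient_square_sum n \<le> n * totient d"
  shows "n div d < p"
proof (cases "p = 2")
  case False
  then show ?thesis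
    using codivisor_less_max_prime_odd[of n d p] assms prime_ge_2_nat[of p] by simp
next
  case True
  obtain m a e b where dec: "n = m * 2 ^ a" "d = e * 2 ^ b" "\<not> 2 dvd m" "e dvd m" "a > 0" "b \<le> a"
    using prime_power_decomposition[of 2 n d] assms True by (metis two_is_prime_nat not_gr0 not_less0)
  have "m = 1"
  proof (rule ccontr)
    assume "m \<noteq> 1"
    then obtain q where q: "prime q" "q dvd m"
      using prime_factor_nat by blast
    then have "q \<le> 2"
      using max True dec by auto
    then show False
      using q dec prime_ge_2_nat[of q] by (metis le_antisym)
  qed
  then have nd: "n = 2 ^ a" "d = 2 ^ b"
    using dec by auto
  have sq: "3 * totient_square_sum n = n\<^sup>2 + 2"
  proof -
    have "real (3 * totient_square_sum n) = real (n\<^sup>2 + 2)"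
      using totient_square_sum_prime_power[of 2 a] nd by simp
    then show ?thesis
      using of_nat_eq_iff by blast
  qed
  have "b = a"
  proof (rule ccontr)
    assume "b \<noteq> a"
    then have "b < a"
      using dec by simp
    have "3 * (n * totient d) < n\<^sup>2 + 2"
    proof (cases "b = 0")
      case True
      have "3 * n \<le> n * n"
        using assms(1) by (intro mult_right_mono) auto
      moreover have "totient d = 1"
        using True nd by simp
      ultimately show ?thesis
        by (simp add: power2_eq_square less_Suc_eq_le le_SucI)
    next
      case False
      have "2 * d \<le> n"
        using \<open>b < a\<close> unfolding nd by (metis Suc_leI one_le_numeral power_Suc power_increasing)
      moreover have "2 * totient d = d"
        using totient_prime_power_Suc[of 2 "b - 1"] False nd by (simp flip: power_Suc)
      ultimately have "3 * totient d \<le> n"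
        by linarith
      then have "n * (3 * totient d) \<le> n\<^sup>2"
        unfolding power2_eq_square by (rule mult_left_mono) simp
      then show ?thesis
        by linarith
    qed
    then show False
      using sq le by linarith
  qed
  then show ?thesis
    using nd True by simp
qed

section \<open>Totient sums of cyclic groups and averaging\<close>

text \<open>The summand is the totient of the order of the \<open>k\<close>-th power of an element
  of order \<open>n\<close>. Grouping by \<open>d = gcd n k\<close> gives
  \<open>totient (n div d)\<close> equal terms \<open>totient (n div d)\<close>.\<close>

lemma sum_totient_codivisor_gcd:
  assumes "n > 0"
  shows "(\<Sum>k\<in>{0<..n}. totient (n div gcd n k)) = totient_square_sum n"
proof -
  have "(\<Sum>k\<in>{0<..n}. totient (n div gcd n k))
      = (\<Sum>d | d dvd n. \<Sum>k | k \<in> {0<..n} \<and> gcd n k = d. totient (n div gcd n k))"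
    using assms by (intro sum.group[symmetric]) auto
  also have "\<dots> = (\<Sum>d | d dvd n. (totient (n div d))\<^sup>2)"
  proof (rule sum.cong[OF refl])
    fix d assume "d \<in> {d. d dvd n}"
    then have "card {k \<in> {0<..n}. gcd n k = d} = totient (n div d)"
      using card_gcd_eq_totient[OF assms, of d] by (simp add: gcd.commute)
    then show "(\<Sum>k | k \<in> {0<..n} \<and> gcd n k = d. totient (n div gcd n k)) = (totient (n div d))\<^sup>2"
      by (simp add: power2_eq_square)
  qed
  also have "\<dots> = totient_square_sum n"
    unfolding totient_square_sum_def
    by (rule sum.reindex_bij_witness[of _ "\<lambda>d. n div d" "\<lambda>d. n div d"]) (use assms in auto)
  finally show ?thesis .
qed

context group
begin

lemma generate_eq_powers:
  assumes "finite (carrier G)" "x \<in> carrier G"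
  shows "generate G {x} = (\<lambda>k. x [^] k) ` {1..ord x}"
proof (rule sym, rule card_subset_eq)
  show "finite (generate G {x})"
    using assms generate_incl[of "{x}"] finite_subset by blast
  show "(\<lambda>k. x [^] k) ` {1..ord x} \<subseteq> generate G {x}"
    using generate_pow_on_finite_carrier[OF assms] by auto
  show "card ((\<lambda>k. x [^] k) ` {1..ord x}) = card (generate G {x})"
    using card_image[OF ord_inj'[OF assms(2)]] generate_pow_card[OF assms(2)] by simp
qed

text \<open>Stated for a cyclic subgroup with orders taken in \<open>G\<close>, so that it serves
  both a cyclic \<open>G\<close> and the cyclic kernel of a quotient map.\<close>

lemma sum_totient_ord_generate:
  assumes "finite (carrier G)" "x \<in> carrier G"
  shows "(\<Sum>y\<in>generate G {x}. totient (ord y)) = totient_square_sum (ord x)"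
proof -
  have "(\<Sum>y\<in>generate G {x}. totient (ord y)) = (\<Sum>k=1..ord x. totient (ord (x [^] k)))"
    unfolding generate_eq_powers[OF assms] by (rule sum.reindex_cong[OF ord_inj'[OF assms(2)]]) auto
  also have "\<dots> = (\<Sum>k\<in>{0<..ord x}. totient (ord x div gcd (ord x) k))"
    using assms by (intro sum.cong) (auto simp: ord_pow_gen)
  also have "\<dots> = totient_square_sum (ord x)"
    using ord_ge_1[OF assms] by (intro sum_totient_codivisor_gcd) simp
  finally show ?thesis .
qed

lemma generate_eq_carrier:
  assumes "finite (carrier G)" "x \<in> carrier G" "ord x = order G"
  shows "generate G {x} = carrier G"
  using assms generate_incl[of "{x}"] generate_pow_card[of x]
  by (intro card_subset_eq) (auto simp: order_def)

lemma group_totient_cyclic: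
  assumes "finite (carrier G)" "x \<in> carrier G" "ord x = order G"
  shows "group_totient G = totient_square_sum (order G)"
  using sum_totient_ord_generate[OF assms(1,2)] generate_eq_carrier[OF assms] assms(3)
  by (simp add: group_totient_def)

lemma exists_totient_ord_ge_average:
  assumes "finite (carrier G)"
  obtains g where "g \<in> carrier G" "group_totient G \<le> order G * totient (ord g)"
proof -
  have "\<exists>g\<in>carrier G. group_totient G \<le> order G * totient (ord g)"
  proof (rule ccontr)
    assume "\<not> ?thesis"
    then have "(\<Sum>g\<in>carrier G. order G * totient (ord g)) < (\<Sum>g\<in>carrier G. group_totient G)"
      using assms by (intro sum_strict_mono) (auto simp: not_le)
    then show False
      by (simp add: group_totient_def order_def flip: sum_distrib_left)
  qed
  then show thesis
    using that by blast
qed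

section \<open>The cyclic normal Sylow subgroup and its quotient\<close>

text \<open>By the index bound, two of the right cosets of \<open>\<langle>g\<rangle>\<close> by \<open>1, v, \<dots>, v^(p - 1)\<close> coincide.\<close>

lemma prime_power_ord_mem_generate:
  assumes fin: "finite (carrier G)" and p: "prime p"
    and g: "g \<in> carrier G" "order G div ord g < p"
    and v: "v \<in> carrier G" "v [^] (p ^ a) = \<one>"
  shows "v \<in> generate G {g}"
proof -
  let ?H = "generate G {g}"
  have H: "subgroup ?H G"
    using g by (intro generate_is_subgroup) auto
  have "card (rcosets ?H) * ord g = order G"
    using lagrange[OF H] generate_pow_card[OF g(1)] by simp
  moreover have "ord g > 0"
    using ord_ge_1[OF fin g(1)] by simp
  ultimately have "card (rcosets ?H) < p"
    using g(2) by (metis nonzero_mult_div_cancel_right less_not_refl)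
  moreover have "finite (rcosets ?H)"
    using fin by (metis H finite_Pow_iff finite_subset rcosets_subset_PowG)
  moreover have "(\<lambda>i. ?H #> v [^] i) ` {..<p} \<subseteq> rcosets ?H"
    using v H by (auto intro!: rcosetsI subgroup.subset)
  ultimately have "\<not> inj_on (\<lambda>i::nat. ?H #> v [^] i) {..<p}"
    by (metis card_inj_on_le card_lessThan not_less)
  then obtain i j :: nat where ij: "i < j" "j < p" "?H #> v [^] i = ?H #> v [^] j"
    unfolding inj_on_def by (metis lessThan_iff nat_neq_iff)
  have "v [^] j \<in> ?H #> v [^] i"
    using ij(3) rcos_self[OF _ H] v by simp
  then have "v [^] j \<otimes> inv (v [^] i) \<in> ?H"
    using subgroup.rcos_module_imp[OF H is_group] v by simp
  moreover have "v [^] j = v [^] (j - i) \<otimes> v [^] i"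
    using ij v by (simp add: nat_pow_mult)
  ultimately have w: "v [^] (j - i) \<in> ?H"
    using v by (simp add: m_assoc)
  \<comment> \<open>Since \<open>0 < j - i < p\<close>, the exponent has an inverse \<open>c\<close>
    modulo \<open>p^a\<close>, so \<open>v\<close> is the \<open>c\<close>-th power of an element of
    the subgroup.\<close>
  have "\<not> p dvd j - i"
    using ij by (auto dest: dvd_imp_le)
  then have "coprime (j - i) (p ^ a)"
    using p by (metis coprime_commute coprime_power_right_iff prime_imp_coprime)
  then obtain c where "[(j - i) * c = Suc 0] (mod (p ^ a))"
    using cong_solve_coprime_nat by blast
  then have "[int ((j - i) * c) = 1] (mod (int (p ^ a)))"
    by (metis cong_int_iff of_nat_1 One_nat_def)
  moreover have "int (ord v) dvd int (p ^ a)"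
    using v pow_eq_id by (metis int_dvd_int_iff)
  ultimately have "int (ord v) dvd (1 - int ((j - i) * c))"
    by (metis cong_iff_dvd_diff dvd_trans cong_sym)
  then have "v [^] int ((j - i) * c) = v [^] (1::int)"
    using int_pow_eq[OF v(1)] by blast
  then have "(v [^] (j - i)) [^] c = v"
    using v by (simp add: int_pow_int nat_pow_pow del: of_nat_mult)
  then show ?thesis
    using subgroup_int_pow_closed[OF H w, of "int c"] by (simp add: int_pow_int)
qed

text \<open>The index of the subgroup generated by \<open>g\<close> is below \<open>p\<close>, hence
  prime to \<open>p\<close>, so \<open>p^a\<close> divides \<open>ord g\<close> and a power
  \<open>u\<close> of \<open>g\<close> has order \<open>p^a\<close>. All solutions of
  \<open>v^(p^a) = 1\<close> are powers of \<open>g\<close>, hence of \<open>u\<close>; conjugation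
  permutes these solutions, which gives normality.\<close>

lemma cyclic_normal_sylow:
  assumes fin: "finite (carrier G)" and p: "prime p"
    and n: "order G = m * p ^ a" "\<not> p dvd m"
    and g: "g \<in> carrier G" "order G div ord g < p"
  obtains u where "u \<in> carrier G" "ord u = p ^ a" "generate G {u} \<lhd> G"
proof -
  obtain k where k: "order G = ord g * k"
    using ord_dvd_group_order[OF g(1)] by (auto elim: dvdE)
  have "order G > 0"
    using fin order_gt_0_iff_finite by blast
  then have "k > 0" "ord g > 0"
    using k by auto
  then have "k < p"
    using g(2) k by simp
  then have "\<not> p dvd k"
    using \<open>k > 0\<close> by (auto dest: dvd_imp_le)
  then have "coprime (p ^ a) k"
    using p by (simp add: prime_imp_coprime)
  moreover have "p ^ a dvd ord g * k"
    using n k by (metis dvd_triv_right)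
  ultimately have pa: "p ^ a dvd ord g"
    by (simp add: coprime_dvd_mult_left_iff)
  define l where "l = ord g div p ^ a"
  have l: "ord g = l * p ^ a"
    using pa by (simp add: l_def)
  then have "l > 0"
    using \<open>ord g > 0\<close> by (cases l) auto
  define u where "u = g [^] l"
  have u: "u \<in> carrier G"
    using g by (simp add: u_def)
  have ord_u: "ord u = p ^ a"
    unfolding u_def using ord_pow[OF g(1), of l] l \<open>l > 0\<close> by simp
  have mem: "v \<in> generate G {u}" if v: "v \<in> carrier G" "v [^] (p ^ a) = \<one>" for v
  proof -
    obtain i :: nat where i: "v = g [^] i"
      using prime_power_ord_mem_generate[OF fin p g v] generate_pow_on_finite_carrier[OF fin g(1)]
      by auto
    then have "ord g dvd i * p ^ a"
      using v g by (simp add: nat_pow_pow pow_eq_id)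
    then have "l dvd i"
      using l p by (simp add: prime_gt_0_nat)
    then obtain c where "i = l * c"
      by (auto elim: dvdE)
    then have "v = u [^] c"
      using i g by (simp add: u_def nat_pow_pow)
    then show ?thesis
      using generate_pow_on_finite_carrier[OF fin u] by auto
  qed
  have "generate G {u} \<lhd> G"
    unfolding normal_inv_iff
  proof (intro conjI ballI)
    show H: "subgroup (generate G {u}) G"
      using u by (intro generate_is_subgroup) auto
    fix x h
    assume x: "x \<in> carrier G" and h: "h \<in> generate G {u}"
    then have hc: "h \<in> carrier G"
      using subgroup.mem_carrier[OF H] by blast
    obtain i :: nat where "h = u [^] i"
      using h generate_pow_on_finite_carrier[OF fin u] by auto
    then have "h [^] (p ^ a) = \<one>"
      using u ord_u by (simp add: nat_pow_pow pow_eq_id)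
    moreover have "(x \<otimes> h \<otimes> inv x) [^] j = x \<otimes> h [^] j \<otimes> inv x" for j :: nat
    proof (induction j)
      case (Suc j)
      have "inv x \<otimes> (x \<otimes> z) = z" if "z \<in> carrier G" for z
        using x that by (simp flip: m_assoc)
      then show ?case
        using Suc x hc by (simp add: m_assoc)
    qed (use x in simp)
    ultimately show "x \<otimes> h \<otimes> inv x \<in> generate G {u}"
      using x hc by (intro mem) auto
  qed
  then show thesis
    using that u ord_u by blast
qed

text \<open>The quotient is carried by coset representatives, so that it has the same element type as \<open>G\<close>
  and the induction on the order can be stated.\<close>

lemma quotient_on_representatives:
  assumes "H \<lhd> G"
  obtains f and K :: "'a monoid" where "group_hom G K f" "f ` carrier G = carrier K"
    "\<And>a. a \<in> carrier G \<Longrightarrow> {b \<in> carrier G. f b = f a} = a <# H" "kernel G K f = H"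
proof -
  \<comment> \<open>The choice depends on \<open>a\<close> only through its coset, so equal values
    of \<open>f\<close> mean equal cosets.\<close>
  define f where "f a = (SOME y. y \<in> H #> a)" for a
  have H: "subgroup H G"
    using assms normal_imp_subgroup by blast
  have f: "f a \<in> H #> a" if "a \<in> carrier G" for a
    unfolding f_def using rcos_self[OF that H] by (rule someI)
  have "weak_group_morphism f H G"
  proof (rule weak_group_morphismsI[OF assms])
    fix a b assume ab: "a \<in> carrier G" "b \<in> carrier G"
    have "f a = f b \<longleftrightarrow> H #> a = H #> b"
      using repr_independence[OF f[OF ab(1)] ab(1) H] repr_independence[OF f[OF ab(2)] ab(2) H]
      by (auto simp: f_def)
    also have "\<dots> \<longleftrightarrow> a \<in> H #> b"
      using rcos_self[OF ab(1) H] repr_independence[OF _ ab(2) H] by auto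
    also have "\<dots> \<longleftrightarrow> a \<otimes> inv b \<in> H"
      using subgroup.rcos_module[OF H is_group ab(2,1)] .
    finally show "f a = f b \<longleftrightarrow> a \<otimes> inv b \<in> H" .
  qed
  note weak = this
  show thesis
  proof (rule that)
    show "group_hom G (image_group f G) f" "kernel G (image_group f G) f = H"
      using weak weak_group_morphism_group_hom weak_group_morphism_ker by blast+
    show "f ` carrier G = carrier (image_group f G)"
      by (simp add: image_group_carrier)
    show "{b \<in> carrier G. f b = f a} = a <# H" if "a \<in> carrier G" for a
      using weak that by (rule vimage_eq_rcoset)
  qed
qed

end

section \<open>Totient sums over the fibres of the quotient map\<close>

text \<open>The left side bounds the sum over a fibre when no \<open>m\<close>-th power generates
  the kernel. As \<open>p \<le> (p - 1)^2\<close>, it is at most the single term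
  \<open>(totient (p^a))^2\<close>, and the divisor 1 makes the inequality strict. For
  \<open>p = 2\<close>, \<open>a = 1\<close> both sides equal 2.\<close>

lemma prime_power_mult_totient_less:
  assumes "prime p" "p \<ge> 3" "a > 0"
  shows "p ^ a * totient (p ^ (a - 1)) < totient_square_sum (p ^ a)"
proof -
  obtain k where a: "a = Suc k"
    using assms by (cases a) auto
  obtain r where r: "p = Suc (Suc (Suc r))"
    using assms by (metis numeral_3_eq_3 le_Suc_ex add_Suc add_0)
  have "p \<le> (p - 1)\<^sup>2"
    by (simp add: r power2_eq_square)
  have "p ^ a * totient (p ^ (a - 1)) \<le> p ^ a * p ^ k"
    using a by (simp add: totient_le)
  also have "\<dots> = (p ^ k)\<^sup>2 * p"
    by (simp add: a power2_eq_square)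
  also have "\<dots> \<le> (p ^ k)\<^sup>2 * (p - 1)\<^sup>2"
    using \<open>p \<le> (p - 1)\<^sup>2\<close> by (rule mult_left_mono) simp
  also have "\<dots> = (totient (p ^ a))\<^sup>2"
    using totient_prime_power_Suc[OF assms(1), of k] by (simp only: a power_mult_distrib)
  also have "\<dots> < (\<Sum>d\<in>{1, p ^ a}. (totient d)\<^sup>2)"
    using assms by (simp add: a)
  also have "\<dots> \<le> totient_square_sum (p ^ a)"
    unfolding totient_square_sum_def using assms by (intro sum_mono2) (auto simp: prime_gt_0_nat)
  finally show ?thesis .
qed

lemma (in group_hom) ord_eq_ord_mult:
  assumes "finite (carrier G)" "y \<in> carrier G" "finite (carrier H)"
  shows "G.ord y = H.ord (h y) * G.ord (y [^] H.ord (h y))"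
proof -
  have "h y [^]\<^bsub>H\<^esub> G.ord y = \<one>\<^bsub>H\<^esub>"
    using assms by (metis G.pow_ord_eq_1 hom_nat_pow hom_one)
  then have dvd: "H.ord (h y) dvd G.ord y"
    using assms H.pow_eq_id by simp
  moreover have "H.ord (h y) \<noteq> 0"
    using H.ord_ge_1[of "h y"] assms by simp
  ultimately show ?thesis
    using G.ord_pow[OF assms(2) dvd] by simp
qed

text \<open>An element \<open>y\<close> of the fibre over \<open>x\<close> has order \<open>m * ord (y^m)\<close>, where \<open>m = ord x\<close>. If some \<open>y^m\<close>
  generates the kernel, then \<open>y\<close> centralizes the kernel, and \<open>y h \<mapsto> (y h)^m = y^m h^m\<close> maps the
  fibre bijectively onto the kernel. Otherwise all \<open>y^m\<close> have order at most \<open>p ^ (a - 1)\<close>.\<close>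

lemma (in group_hom) sum_totient_fibre:
  assumes fin: "finite (carrier G)" "finite (carrier H)"
    and p: "prime p" "p \<ge> 3" "a > 0" "\<not> p dvd order H"
    and u: "u \<in> carrier G" "G.ord u = p ^ a" "kernel G H h = generate G {u}"
    and fibre: "\<And>y. y \<in> carrier G \<Longrightarrow> {z \<in> carrier G. h z = h y} = y <#\<^bsub>G\<^esub> generate G {u}"
    and x: "x \<in> h ` carrier G"
  defines "X \<equiv> {y \<in> carrier G. h y = x}"
  shows "(\<Sum>y\<in>X. totient (G.ord y)) \<le> totient (H.ord x) * totient_square_sum (p ^ a)"
    and "(\<Sum>y\<in>X. totient (G.ord y)) = totient (H.ord x) * totient_square_sum (p ^ a)
      \<Longrightarrow> \<exists>y\<in>X. G.ord y = H.ord x * p ^ a"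
proof -
  define m where "m = H.ord x"
  define Q where "Q = generate G {u}"
  have Q: "subgroup Q G"
    unfolding Q_def using u by (intro G.generate_is_subgroup) auto
  have QG: "Q \<subseteq> carrier G"
    using Q by (rule subgroup.subset)
  have finQ: "finite Q"
    using QG fin finite_subset by blast
  have card_Q: "card Q = p ^ a"
    unfolding Q_def using G.generate_pow_card[OF u(1)] u(2) by simp
  have xH: "x \<in> carrier H"
    using x by auto
  have m_pos: "m > 0"
    using H.ord_ge_1[OF fin(2) xH] by (simp add: m_def)
  have "m dvd order H"
    unfolding m_def using xH by (rule H.ord_dvd_group_order)
  then have "\<not> p dvd m"
    using p by (meson dvd_trans)
  then have cop: "coprime m (p ^ a)"
    using p by (metis coprime_commute coprime_power_right_iff prime_imp_coprime)
  have bij: "bij_betw (\<lambda>v. y \<otimes>\<^bsub>G\<^esub> v) Q X" if "y \<in> X" for y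
  proof -
    have "X = (\<lambda>v. y \<otimes>\<^bsub>G\<^esub> v) ` Q"
      using fibre[of y] that by (auto simp: X_def Q_def l_coset_def)
    moreover have "inj_on (\<lambda>v. y \<otimes>\<^bsub>G\<^esub> v) Q"
      using that QG by (auto simp: X_def inj_on_def subset_iff)
    ultimately show ?thesis
      by (simp add: bij_betw_def)
  qed
  have pow_mem: "y [^]\<^bsub>G\<^esub> m \<in> Q" if "y \<in> X" for y
  proof -
    have "h (y [^]\<^bsub>G\<^esub> m) = \<one>\<^bsub>H\<^esub>"
      using that xH by (simp add: X_def hom_nat_pow m_def)
    then have "y [^]\<^bsub>G\<^esub> m \<in> kernel G H h"
      using that by (simp add: X_def kernel_def)
    then show ?thesis
      using u(3) by (simp add: Q_def)
  qed
  have ord_Q: "G.ord v dvd p ^ a" if v: "v \<in> Q" for v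
  proof -
    obtain k :: nat where "v = u [^]\<^bsub>G\<^esub> k"
      using v G.generate_pow_on_finite_carrier[OF fin(1) u(1)] by (auto simp: Q_def)
    then have "v \<in> carrier G" "v [^]\<^bsub>G\<^esub> (p ^ a) = \<one>\<^bsub>G\<^esub>"
      using u(1,2) by (auto simp: G.nat_pow_pow G.pow_eq_id)
    then show ?thesis
      by (simp add: G.pow_eq_id)
  qed
  have ord_X: "G.ord y = m * G.ord (y [^]\<^bsub>G\<^esub> m)" if "y \<in> X" for y
    using ord_eq_ord_mult[of y] fin that by (simp add: X_def m_def)
  have "(\<Sum>y\<in>X. totient (G.ord y)) = (\<Sum>y\<in>X. totient m * totient (G.ord (y [^]\<^bsub>G\<^esub> m)))"
  proof (rule sum.cong[OF refl])
    fix y assume y: "y \<in> X"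
    \<comment> \<open>The order of \<open>y^m\<close> divides \<open>p^a\<close>, which is prime to
      \<open>m\<close>, so the totient of \<open>ord y\<close> splits and \<open>totient m\<close>
      leaves the sum.\<close>
    then have "coprime m (G.ord (y [^]\<^bsub>G\<^esub> m))"
      using cop ord_Q[OF pow_mem] coprime_divisors dvd_refl by blast
    then show "totient (G.ord y) = totient m * totient (G.ord (y [^]\<^bsub>G\<^esub> m))"
      by (subst ord_X[OF y]) (rule totient_mult_coprime)
  qed
  then have sum_X: "(\<Sum>y\<in>X. totient (G.ord y))
      = totient m * (\<Sum>y\<in>X. totient (G.ord (y [^]\<^bsub>G\<^esub> m)))"
    by (simp add: sum_distrib_left)
  consider y where "y \<in> X" "G.ord (y [^]\<^bsub>G\<^esub> m) = p ^ a"
    | "\<And>y. y \<in> X \<Longrightarrow> G.ord (y [^]\<^bsub>G\<^esub> m) \<noteq> p ^ a"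
    by blast
  then have "(\<Sum>y\<in>X. totient (G.ord y)) \<le> totient m * totient_square_sum (p ^ a) \<and>
    ((\<Sum>y\<in>X. totient (G.ord y)) = totient m * totient_square_sum (p ^ a)
      \<longrightarrow> (\<exists>y\<in>X. G.ord y = m * p ^ a))"
  proof cases
    case 1
    define w where "w = y [^]\<^bsub>G\<^esub> m"
    have yG: "y \<in> carrier G"
      using 1 by (simp add: X_def)
    have w: "w \<in> carrier G" "w \<in> Q"
      using pow_mem[OF 1(1)] yG by (auto simp: w_def)
    have "generate G {w} = Q"
    proof (rule card_subset_eq[OF finQ])
      show "generate G {w} \<subseteq> Q"
        using w Q by (intro G.generate_subgroup_incl) auto
      show "card (generate G {w}) = card Q"
        using G.generate_pow_card[OF w(1)] card_Q 1(2) by (simp add: w_def)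
    qed
    then have comm: "y \<otimes>\<^bsub>G\<^esub> v = v \<otimes>\<^bsub>G\<^esub> y" if v: "v \<in> Q" for v
    proof -
      obtain k :: nat where "v = y [^]\<^bsub>G\<^esub> (m * k)"
        using v \<open>generate G {w} = Q\<close> G.generate_pow_on_finite_carrier[OF fin(1) w(1)] yG
        by (auto simp: w_def G.nat_pow_pow)
      then show ?thesis
        using yG G.nat_pow_comm[of y 1 "m * k"] by simp
    qed
    have inj: "inj_on (\<lambda>v. (y \<otimes>\<^bsub>G\<^esub> v) [^]\<^bsub>G\<^esub> m) Q"
    proof (rule inj_onI)
      fix v v' assume v: "v \<in> Q" "v' \<in> Q" "(y \<otimes>\<^bsub>G\<^esub> v) [^]\<^bsub>G\<^esub> m = (y \<otimes>\<^bsub>G\<^esub> v') [^]\<^bsub>G\<^esub> m"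
      then have vG: "v \<in> carrier G" "v' \<in> carrier G"
        using QG by auto
      have "w \<otimes>\<^bsub>G\<^esub> v [^]\<^bsub>G\<^esub> m = w \<otimes>\<^bsub>G\<^esub> v' [^]\<^bsub>G\<^esub> m"
        using v(3) G.pow_mult_distrib[OF comm[OF v(1)] yG vG(1), of m]
          G.pow_mult_distrib[OF comm[OF v(2)] yG vG(2), of m] by (simp add: w_def)
      then have eq: "v [^]\<^bsub>G\<^esub> m = v' [^]\<^bsub>G\<^esub> m"
        using vG w by simp
      \<comment> \<open>With \<open>c\<close> inverse to \<open>m\<close> modulo \<open>p^a\<close>,
        the \<open>c\<close>-th power undoes the \<open>m\<close>-th power on
        \<open>Q\<close>.\<close>
      obtain c where c: "[m * c = Suc 0] (mod (p ^ a))"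
        using cong_solve_coprime_nat[OF cop] by blast
      have root: "(z [^]\<^bsub>G\<^esub> m) [^]\<^bsub>G\<^esub> c = z" if z: "z \<in> Q" for z
      proof -
        have zG: "z \<in> carrier G"
          using z QG by blast
        have "[int (m * c) = int 1] (mod int (p ^ a))"
          using c by (metis cong_int_iff One_nat_def)
        then have "int (p ^ a) dvd int 1 - int (m * c)"
          using cong_iff_dvd_diff cong_sym by blast
        then have "int (G.ord z) dvd int 1 - int (m * c)"
          using ord_Q[OF z] by (meson dvd_trans int_dvd_int_iff)
        then have "z [^]\<^bsub>G\<^esub> int (m * c) = z [^]\<^bsub>G\<^esub> int 1"
          using G.int_pow_eq[OF zG] by blast
        then show ?thesis
          unfolding int_pow_int using zG by (simp add: G.nat_pow_pow)
      qed
      show "v = v'"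
        using root[OF v(1)] root[OF v(2)] eq by metis
    qed
    have "(\<lambda>v. (y \<otimes>\<^bsub>G\<^esub> v) [^]\<^bsub>G\<^esub> m) ` Q = Q"
    proof (rule endo_inj_surj[OF finQ _ inj])
      show "(\<lambda>v. (y \<otimes>\<^bsub>G\<^esub> v) [^]\<^bsub>G\<^esub> m) ` Q \<subseteq> Q"
        using bij[OF 1(1)] pow_mem by (auto simp: bij_betw_def)
    qed
    then have bij_Q: "bij_betw (\<lambda>v. (y \<otimes>\<^bsub>G\<^esub> v) [^]\<^bsub>G\<^esub> m) Q Q"
      using inj by (simp add: bij_betw_def)
    have "(\<Sum>z\<in>X. totient (G.ord (z [^]\<^bsub>G\<^esub> m)))
        = (\<Sum>v\<in>Q. totient (G.ord ((y \<otimes>\<^bsub>G\<^esub> v) [^]\<^bsub>G\<^esub> m)))"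
      by (rule sum.reindex_bij_betw[OF bij[OF 1(1)], symmetric])
    also have "\<dots> = (\<Sum>v\<in>Q. totient (G.ord v))"
      by (rule sum.reindex_bij_betw[OF bij_Q])
    also have "\<dots> = totient_square_sum (p ^ a)"
      unfolding Q_def using G.sum_totient_ord_generate[OF fin(1) u(1)] u(2) by simp
    finally show ?thesis
      using sum_X ord_X[OF 1(1)] 1 by auto
  next
    case 2
    have "(\<Sum>y\<in>X. totient (G.ord (y [^]\<^bsub>G\<^esub> m))) \<le> (\<Sum>y\<in>X. totient (p ^ (a - 1)))"
    proof (rule sum_mono)
      fix y assume y: "y \<in> X"
      obtain i where i: "i \<le> a" "G.ord (y [^]\<^bsub>G\<^esub> m) = p ^ i"
        using ord_Q[OF pow_mem[OF y]] divides_primepow_nat[OF p(1)] by auto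
      moreover have "i \<noteq> a"
        using 2[OF y] i by auto
      ultimately have "i \<le> a - 1"
        by simp
      then show "totient (G.ord (y [^]\<^bsub>G\<^esub> m)) \<le> totient (p ^ (a - 1))"
        using i p by (intro totient_dvd_mono) (auto simp: le_imp_power_dvd prime_gt_0_nat)
    qed
    also have "\<dots> = card X * totient (p ^ (a - 1))"
      by simp
    also have "card X = p ^ a"
    proof -
      obtain y where "y \<in> X"
        using x by (auto simp: X_def)
      then show ?thesis
        using bij_betw_same_card[OF bij] card_Q by simp
    qed
    also have "p ^ a * totient (p ^ (a - 1)) < totient_square_sum (p ^ a)"
      using p by (intro prime_power_mult_totient_less) auto
    finally have "(\<Sum>y\<in>X. totient (G.ord y)) < totient m * totient_square_sum (p ^ a)"
      unfolding sum_X using m_pos by (intro mult_strict_left_mono) auto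
    then show ?thesis
      by simp
  qed
  then show "(\<Sum>y\<in>X. totient (G.ord y)) \<le> totient (H.ord x) * totient_square_sum (p ^ a)"
    and "(\<Sum>y\<in>X. totient (G.ord y)) = totient (H.ord x) * totient_square_sum (p ^ a)
      \<Longrightarrow> \<exists>y\<in>X. G.ord y = H.ord x * p ^ a"
    by (auto simp: m_def)
qed

section \<open>Induction on the group order\<close>

text \<open>The hypothesis \<open>IH\<close> concerns plain monoids only, because the quotient built
  on representatives is one, while \<open>G\<close> may be any record extension. The induction is
  run for plain monoids, and one more application of the step covers the general case.\<close>

lemma (in group) extremal_totient_step:
  assumes fin: "finite (carrier G)"
    and large: "totient_square_sum (order G) \<le> group_totient G"
    and IH: "\<And>K :: 'a monoid. group K \<Longrightarrow> finite (carrier K) \<Longrightarrow> order K < order G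
      \<Longrightarrow> totient_square_sum (order K) \<le> group_totient K \<Longrightarrow> \<exists>x\<in>carrier K. group.ord K x = order K"
  shows "\<exists>g\<in>carrier G. ord g = order G"
proof -
  define n where "n = order G"
  have n_pos: "n > 0"
    using fin order_gt_0_iff_finite by (simp add: n_def)
  consider "n = 1" | "n = 2" | "n > 2"
    using n_pos by linarith
  then show ?thesis
  proof cases
    case 1
    then show ?thesis
      using ord_id one_closed by (metis n_def)
  next
    case 2
    then have "card (carrier G) = 2"
      by (simp add: n_def order_def)
    then have "\<not> carrier G \<subseteq> {\<one>}"
      using card_mono[of "{\<one>}" "carrier G"] by auto
    then obtain g where g: "g \<in> carrier G" "g \<noteq> \<one>"
      by auto
    then have "ord g dvd 2" "ord g \<noteq> 1"
      using ord_dvd_group_order[of g] 2 ord_eq_1[of g] by (auto simp: n_def)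
    then show ?thesis
      using g 2 by (metis n_def prime_nat_iff two_is_prime_nat)
  next
    case 3
    define p where "p = Max (prime_factors n)"
    have "prime_factors n \<noteq> {}"
      using 3 prime_factorization_empty_iff[of n] by auto
    then have "p \<in> prime_factors n"
      unfolding p_def by (intro Max_in) auto
    then have p: "prime p" "p dvd n"
      by auto
    have max: "q \<le> p" if "prime q" "q dvd n" for q
      unfolding p_def using that n_pos by (intro Max_ge) (auto simp: prime_factors_dvd)
    obtain g where g: "g \<in> carrier G" "group_totient G \<le> n * totient (ord g)"
      using exists_totient_ord_ge_average[OF fin] by (auto simp: n_def)
    have ord_g: "ord g dvd n"
      using ord_dvd_group_order[OF g(1)] by (simp add: n_def)
    have index: "n div ord g < p"
      using codivisor_less_max_prime[OF 3 ord_g p max] large g by (simp add: n_def)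
    show ?thesis
    proof (cases "p = 2")
      \<comment> \<open>An index below 2 makes \<open>g\<close> itself a generator; the fibre
        estimate is available only for \<open>p \<ge> 3\<close>.\<close>
      case True
      obtain k where k: "n = ord g * k"
        using ord_g by (auto elim: dvdE)
      then have "k < 2" "k > 0"
        using True index n_pos by auto
      then have "ord g = n"
        using k by simp
      then show ?thesis
        using g(1) by (auto simp: n_def)
    next
      case False
      then have p3: "p \<ge> 3"
        using prime_ge_2_nat[OF p(1)] by simp
      obtain m a where dec: "n = m * p ^ a" "\<not> p dvd m" "a > 0" "coprime m (p ^ a)"
        using prime_power_decomposition[OF p n_pos dvd_refl] by metis
      define q where "q = p ^ a"
      have q: "q > 1"
        unfolding q_def using dec p3 by (intro one_less_power) auto
      obtain u where u: "u \<in> carrier G" "ord u = p ^ a" "generate G {u} \<lhd> G"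
        using cyclic_normal_sylow[OF fin p(1) dec(1)[unfolded n_def] dec(2) g(1)] index
        by (auto simp: n_def)
      obtain f and K :: "'a monoid" where K: "group_hom G K f" "f ` carrier G = carrier K"
        "\<And>a. a \<in> carrier G \<Longrightarrow> {b \<in> carrier G. f b = f a} = a <# generate G {u}"
        "kernel G K f = generate G {u}"
        by (rule quotient_on_representatives[OF u(3)]) (rule that)
      interpret f: group_hom G K f
        by (rule K(1))
      have finK: "finite (carrier K)"
        using fin K(2) by (metis finite_imageI)
      define X where "X x = {y \<in> carrier G. f y = x}" for x
      have sub: "subgroup (generate G {u}) G"
        using u(3) normal_imp_subgroup by blast
      have card_X: "card (X x) = q" if x: "x \<in> carrier K" for x
      proof -
        obtain y where y: "y \<in> carrier G" "x = f y"
          using x K(2) by auto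
        then have "X x = (\<lambda>v. y \<otimes> v) ` generate G {u}"
          using K(3)[OF y(1)] by (auto simp: X_def l_coset_def)
        moreover have "inj_on (\<lambda>v. y \<otimes> v) (generate G {u})"
          using y subgroup.subset[OF sub] by (auto simp: inj_on_def subset_iff)
        ultimately show ?thesis
          using generate_pow_card[OF u(1)] u(2) by (simp add: card_image q_def)
      qed
      have split: "sum F (carrier G) = (\<Sum>x\<in>carrier K. sum F (X x))" for F :: "'a \<Rightarrow> nat"
        unfolding X_def using fin finK K(2) by (intro sum.group[symmetric]) auto
      have "n = (\<Sum>x\<in>carrier K. card (X x))"
        using split[of "\<lambda>_. 1"] by (simp add: n_def order_def)
      also have "\<dots> = order K * q"
        using card_X by (simp add: order_def)
      finally have ordK: "order K = m"
        using q unfolding dec(1) q_def[symmetric] by simp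
      have m_pos: "m > 0"
        using dec(1) n_pos by auto
      have "\<not> p dvd order K"
        using ordK dec(2) by simp
      note fibre_lemma = f.sum_totient_fibre[OF fin finK p(1) p3 dec(3) this u(1,2) K(4) K(3),
          folded q_def X_def, unfolded K(2)]
      have fibre: "(\<Sum>y\<in>X x. totient (ord y)) \<le> totient (f.H.ord x) * totient_square_sum q"
        if "x \<in> carrier K" for x
        using that by (rule fibre_lemma(1)[rotated])
      have fibre_eq: "\<exists>y\<in>X x. ord y = f.H.ord x * q"
        if "x \<in> carrier K"
          "(\<Sum>y\<in>X x. totient (ord y)) = totient (f.H.ord x) * totient_square_sum q" for x
        using that by (rule fibre_lemma(2)[rotated])
      \<comment> \<open>The sum over all fibres lies between \<open>F m * F q\<close> and
        \<open>group_totient K * F q\<close>; cancelling \<open>F q\<close> shows that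
        \<open>K\<close> is extremal.\<close>
      have "totient_square_sum m * totient_square_sum q = totient_square_sum n"
        unfolding dec(1) q_def using dec m_pos p
        by (intro totient_square_sum_mult_coprime[symmetric]) (auto simp: prime_gt_0_nat)
      also have "\<dots> \<le> (\<Sum>x\<in>carrier K. \<Sum>y\<in>X x. totient (ord y))"
        using large split by (simp add: n_def group_totient_def)
      finally have lower: "totient_square_sum m * totient_square_sum q
          \<le> (\<Sum>x\<in>carrier K. \<Sum>y\<in>X x. totient (ord y))" .
      also have "\<dots> \<le> (\<Sum>x\<in>carrier K. totient (f.H.ord x) * totient_square_sum q)"
        using fibre by (rule sum_mono)
      also have "\<dots> = group_totient K * totient_square_sum q"
        by (simp add: group_totient_def sum_distrib_right)
      finally have "totient_square_sum (order K) \<le> group_totient K"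
        using totient_square_sum_pos[of q] q ordK by simp
      moreover have "order K < order G"
        using ordK dec(1) q m_pos by (simp add: n_def q_def)
      ultimately obtain x where x: "x \<in> carrier K" "f.H.ord x = order K"
        using IH[OF f.H.is_group finK] by blast
      \<comment> \<open>Once \<open>K\<close> is cyclic, \<open>group_totient K = F m\<close> and
        the two bounds coincide, so strict inequality in a single fibre is impossible.\<close>
      have "(\<Sum>y\<in>X x. totient (ord y)) = totient (f.H.ord x) * totient_square_sum q"
      proof (rule ccontr)
        assume "\<not> ?thesis"
        then have "(\<Sum>x\<in>carrier K. \<Sum>y\<in>X x. totient (ord y))
            < (\<Sum>x\<in>carrier K. totient (f.H.ord x) * totient_square_sum q)"
          using finK x(1) fibre by (intro sum_strict_mono_ex1) (auto simp: order.strict_iff_order)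
        also have "\<dots> = group_totient K * totient_square_sum q"
          by (simp add: group_totient_def sum_distrib_right)
        also have "\<dots> = totient_square_sum m * totient_square_sum q"
          using f.H.group_totient_cyclic[OF finK x] ordK by simp
        finally show False
          using lower by simp
      qed
      then obtain y where "y \<in> X x" "ord y = f.H.ord x * q"
        using fibre_eq[OF x(1)] by blast
      then show ?thesis
        using x ordK dec(1) by (auto simp: X_def q_def n_def)
    qed
  qed
qed

lemma extremal_totient_imp_cyclic_monoid:
  fixes G :: "'a monoid"
  assumes "group G" "finite (carrier G)" "totient_square_sum (order G) \<le> group_totient G"
  shows "\<exists>g\<in>carrier G. group.ord G g = order G"
  using assms
proof (induction "order G" arbitrary: G rule: less_induct)
  case less
  show ?case
    using less.prems by (rule group.extremal_totient_step) (rule less.hyps)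
qed

lemma (in group) extremal_totient_imp_cyclic:
  assumes "finite (carrier G)" "totient_square_sum (order G) \<le> group_totient G"
  shows "\<exists>g\<in>carrier G. ord g = order G"
  by (rule extremal_totient_step[OF assms extremal_totient_imp_cyclic_monoid])

section \<open>The integers modulo \<open>n\<close> and the final comparison\<close>

lemma ord_integer_mod_group_1:
  assumes "n > 1"
  shows "group.ord (integer_mod_group n) 1 = n"
proof -
  have "[int k = 0] (mod int n) \<longleftrightarrow> n dvd k" for k
    by (simp add: cong_0_iff)
  then show ?thesis
    using assms by (subst group.ord_unique[OF group_integer_mod_group]) (auto simp: cong_def)
qed

text \<open>This includes \<open>n = 0\<close>, where the group is the infinite group of integers
  and its order is 0 by the convention for \<open>card\<close>.\<close>

lemma order_integer_mod_group: "order (integer_mod_group n) = n"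
  by (simp add: order_def carrier_integer_mod_group)

lemma integer_mod_group_generator:
  assumes "n > 0"
  shows "\<exists>g\<in>carrier (integer_mod_group n). group.ord (integer_mod_group n) g = n"
\<comment> \<open>For \<open>n = 1\<close> the carrier is \<open>{0}\<close> and does not contain
  1.\<close>
proof (cases "n = 1")
  case True
  then show ?thesis
    using group.ord_id[OF group_integer_mod_group, of n] by (intro bexI[of _ 0]) auto
next
  case False
  then show ?thesis
    using assms ord_integer_mod_group_1[of n] by (intro bexI[of _ 1]) auto
qed

lemma (in group) iso_integer_mod_group:
  assumes "finite (carrier G)" "g \<in> carrier G" "ord g = order G"
  shows "G \<cong> integer_mod_group (order G)"
proof -
  define n where "n = order G"
  have n: "n > 0"
    using assms order_gt_0_iff_finite by (simp add: n_def)
  have pow_eq: "g [^] i = g [^] j \<longleftrightarrow> int n dvd j - i" for i j :: int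
    using int_pow_eq[OF assms(2)] assms(3) by (simp add: n_def)
  let ?f = "\<lambda>i::int. g [^] i"
  have inj: "inj_on ?f {0..<int n}"
  proof (rule inj_onI)
    fix i j assume "i \<in> {0..<int n}" "j \<in> {0..<int n}" "g [^] i = g [^] j"
    then show "i = j"
      using pow_eq by (metis atLeastLessThan_iff mod_eq_dvd_iff mod_pos_pos_trivial)
  qed
  have "?f ` {0..<int n} = carrier G"
    using assms inj by (intro card_subset_eq) (auto simp: card_image n_def order_def)
  then have "bij_betw ?f (carrier (integer_mod_group n)) (carrier G)"
    using inj n by (simp add: bij_betw_def carrier_integer_mod_group)
  moreover have "g [^] ((i + j) mod int n) = g [^] i \<otimes> g [^] j" for i j :: int
  proof -
    have "g [^] ((i + j) mod int n) = g [^] (i + j)"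
      unfolding pow_eq by (simp add: minus_mod_eq_mult_div)
    then show ?thesis
      using assms(2) by (simp add: int_pow_mult)
  qed
  ultimately have "?f \<in> iso (integer_mod_group n) G"
    using assms(2) by (auto simp: iso_def hom_def)
  then show ?thesis
    using group.iso_sym[OF group_integer_mod_group] by (auto simp: is_iso_def n_def)
qed

text \<open>The image of a generator works: injectivity pulls the relation for its order back, so
  \<open>order G\<close> divides that order, and Lagrange gives the converse.\<close>

lemma (in group) exists_ord_eq_order_of_iso:
  assumes "finite (carrier G)" "G \<cong> integer_mod_group (order G)"
  shows "\<exists>g\<in>carrier G. ord g = order G"
proof -
  obtain h where "h \<in> iso (integer_mod_group (order G)) G"
    using iso_sym[OF assms(2)] by (auto simp: is_iso_def)
  then interpret h: group_hom "integer_mod_group (order G)" G h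
    by (auto simp: group_hom_def group_hom_axioms_def iso_def)
  have inj: "inj_on h (carrier (integer_mod_group (order G)))"
    using \<open>h \<in> iso _ _\<close> by (auto simp: iso_def bij_betw_def)
  have "order G > 0"
    using assms order_gt_0_iff_finite by simp
  then obtain x where x: "x \<in> carrier (integer_mod_group (order G))" "h.G.ord x = order G"
    using integer_mod_group_generator by blast
  have "x [^]\<^bsub>integer_mod_group (order G)\<^esub> ord (h x) = \<one>\<^bsub>integer_mod_group (order G)\<^esub>"
  proof (rule inj_onD[OF inj])
    show "h (x [^]\<^bsub>integer_mod_group (order G)\<^esub> ord (h x)) = h \<one>\<^bsub>integer_mod_group (order G)\<^esub>"
      using x(1) h.hom_nat_pow[of x] by (simp del: pow_integer_mod_group one_integer_mod_group)
  qed (use x in \<open>auto simp del: pow_integer_mod_group one_integer_mod_group\<close>)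
  then have "order G dvd ord (h x)"
    using x h.G.pow_eq_id by metis
  then have "ord (h x) = order G"
    using ord_dvd_group_order[of "h x"] x(1) dvd_antisym by simp
  then show ?thesis
    using h.hom_closed[OF x(1)] by (intro bexI[of _ "h x"])
qed

theorem theorem1p2:
  fixes G :: "('a, 'b) monoid_scheme" and n :: nat
  assumes "group G" and "finite (carrier G)" and "order G = n"
  shows "group_totient (integer_mod_group n) \<ge> group_totient G \<and>
    (group_totient (integer_mod_group n) = group_totient G \<longleftrightarrow> G \<cong> integer_mod_group n)"
proof -
  interpret group G
    by (rule assms(1))
  have n: "n > 0"
    using assms order_gt_0_iff_finite by blast
  then have fin: "finite (carrier (integer_mod_group n))"
    by (simp add: carrier_integer_mod_group)
  have C: "group_totient (integer_mod_group n) = totient_square_sum n"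
    using integer_mod_group_generator[OF n] group.group_totient_cyclic[OF group_integer_mod_group fin]
    by (auto simp: order_integer_mod_group)
  have cyclic: "group_totient G = totient_square_sum n" if "\<exists>g\<in>carrier G. ord g = order G"
    using that group_totient_cyclic assms by auto
  have extremal: "\<exists>g\<in>carrier G. ord g = order G" if "totient_square_sum n \<le> group_totient G"
    using that extremal_totient_imp_cyclic assms by simp
  \<comment> \<open>A larger value would give a generator by \<open>extremal\<close>, and then
    equality by \<open>cyclic\<close>.\<close>
  have "group_totient G \<le> totient_square_sum n"
    using cyclic extremal by fastforce
  moreover have "totient_square_sum n = group_totient G \<longleftrightarrow> G \<cong> integer_mod_group n"
    using cyclic extremal iso_integer_mod_group exists_ord_eq_order_of_iso assms by auto
  ultimately show ?thesis
    using C by simp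
qed

end
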